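(* For $\lambda>0$ and $(\hat u,\hat w)\in W^{1,2}_{\rm loc}((0,\infty),\mathbb{R}^2)$ let $$\rho_\lambda(r)=(\hat w^2-1+\hat u')^2+\Big(\frac{\hat u}{r}\Big)^2+\lambda^2\Big(\hat w'^2+\frac{\hat w^2}{r^2}\Big),\qquad I_\lambda(\hat u,\hat w)=\int_0^1\rho_\lambda(r)\,r\,dr,$$ and let $\inf I_\lambda$ denote the infimum of $I_\lambda$ over all $(\hat u,\hat w)\in W^{1,2}_{\rm loc}((0,\infty),\mathbb{R}^2)$ with $I_\lambda(\hat u,\hat w)<\infty$. There exist constants $R_0\ge 1$ and $C$, independent of $\lambda$, such that $$|\log\lambda|-C\ \le\ \lambda^{-2}\inf I_\lambda\ \le\ |\log\lambda|+C\qquad\text{for all }\lambda\in(0,R_0^{-1}).$$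
   Context: $W^{1,2}_{\rm loc}((0,\infty),\mathbb{R}^2)$ is the space of pairs of real functions belonging to $W^{1,2}$ on every compact subinterval of $(0,\infty)$; primes denote (weak) derivatives in $r$. *)

theory Defs
  imports "HOL-Analysis.Analysis"
begin

text \<open>Weak derivatives on an open set \<open>S\<close> of reals are taken with respect to
  Lebesgue measure and tested, as is usual for Sobolev spaces on intervals, against \<open>C\<^sup>1\<close>
  functions with compact support in \<open>S\<close>.  Using smooth test functions instead would give the same
  weak derivatives.\<close>

definition test_function :: "real set \<Rightarrow> (real \<Rightarrow> real) \<Rightarrow> bool" where
  "test_function S \<phi> \<longleftrightarrow>
     \<phi> C1_differentiable_on UNIV \<and>
     (\<exists>K. compact K \<and> K \<subseteq> S \<and> (\<forall>x. x \<notin> K \<longrightarrow> \<phi> x = 0))"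

definition locally_integrable_on :: "(real \<Rightarrow> real) \<Rightarrow> real set \<Rightarrow> bool" where
  "locally_integrable_on u S \<longleftrightarrow> (\<forall>K. compact K \<and> K \<subseteq> S \<longrightarrow> set_integrable lebesgue K u)"

definition has_weak_deriv_on ::
    "(real \<Rightarrow> real) \<Rightarrow> (real \<Rightarrow> real) \<Rightarrow> real set \<Rightarrow> bool" where
  "has_weak_deriv_on u v S \<longleftrightarrow>
     locally_integrable_on u S \<and> locally_integrable_on v S \<and>
     (\<forall>\<phi>. test_function S \<phi> \<longrightarrow>
        (LINT x:S|lebesgue. u x * deriv \<phi> x) = - (LINT x:S|lebesgue. v x * \<phi> x))"

text \<open>The choice below is unique only up to null sets; it is used only under integrals.\<close>

definition weak_deriv_on :: "real set \<Rightarrow> (real \<Rightarrow> real) \<Rightarrow> real \<Rightarrow> real" where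
  "weak_deriv_on S u = (SOME v. has_weak_deriv_on u v S)"

definition L2_on :: "real set \<Rightarrow> (real \<Rightarrow> real) \<Rightarrow> bool" where
  "L2_on S u \<longleftrightarrow> set_borel_measurable lebesgue S u \<and> set_integrable lebesgue S (\<lambda>x. (u x)\<^sup>2)"

definition W12_on :: "real set \<Rightarrow> (real \<Rightarrow> real) \<Rightarrow> bool" where
  "W12_on S u \<longleftrightarrow> L2_on S u \<and> (\<exists>v. has_weak_deriv_on u v S \<and> L2_on S v)"

text \<open>Functions are total; the values outside \<open>(0, \<infinity>)\<close> are irrelevant.  A function is
  \<open>W\<^sup>1\<^sup>,\<^sup>2\<close> on \<open>[a, b]\<close> if it is so on the interior.\<close>

definition W12_loc :: "((real \<Rightarrow> real) \<times> (real \<Rightarrow> real)) set" where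
  "W12_loc = {(u, w). \<forall>a b. 0 < a \<and> a < b \<longrightarrow> W12_on {a<..<b} u \<and> W12_on {a<..<b} w}"

definition energy_density ::
    "real \<Rightarrow> (real \<Rightarrow> real) \<Rightarrow> (real \<Rightarrow> real) \<Rightarrow> real \<Rightarrow> real" where
  "energy_density l u w r =
     ((w r)\<^sup>2 - 1 + weak_deriv_on {0<..} u r)\<^sup>2 + (u r / r)\<^sup>2
     + l\<^sup>2 * ((weak_deriv_on {0<..} w r)\<^sup>2 + (w r)\<^sup>2 / r\<^sup>2)"

definition energy :: "real \<Rightarrow> (real \<Rightarrow> real) \<Rightarrow> (real \<Rightarrow> real) \<Rightarrow> ennreal" where
  "energy l u w = (\<integral>\<^sup>+ r \<in> {0<..<1}. ennreal (energy_density l u w r * r) \<partial>lebesgue)"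

text \<open>If no pair had finite energy, this would be \<open>\<infinity>\<close>.\<close>

definition inf_energy :: "real \<Rightarrow> ennreal" where
  "inf_energy l = Inf {energy l u w | u w. (u, w) \<in> W12_loc \<and> energy l u w < \<infinity>}"

end

theory Submission
  imports Defs
begin

text \<open>The upper bound comes from \<open>u = 0\<close>, \<open>w = r / sqrt (r\<^sup>2 + \<lambda>\<^sup>2)\<close>, for which the energy
  density has an explicit primitive.  For the lower bound, take a \<open>C\<^sup>1\<close> weight \<open>0 \<le> \<phi> \<le> 1 / r\<close>
  supported in \<open>[\<lambda>, 1]\<close> with \<open>\<integral> \<phi> \<ge> -ln \<lambda> - 4\<close> and \<open>\<phi>' = O(1 / r\<^sup>2)\<close>, and put \<open>g = w\<^sup>2 - 1 + u'\<close>.  Then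
  \<open>\<lambda>\<^sup>2 w\<^sup>2 / r \<ge> \<lambda>\<^sup>2 \<phi> w\<^sup>2 = \<lambda>\<^sup>2 (\<phi> + g \<phi> - u' \<phi>)\<close>, and the last term integrates to \<open>\<lambda>\<^sup>2 \<integral> u \<phi>'\<close>.
  By AM-GM the terms \<open>\<lambda>\<^sup>2 g \<phi>\<close> and \<open>\<lambda>\<^sup>2 u \<phi>'\<close> are absorbed by \<open>g\<^sup>2 r\<close> and \<open>u\<^sup>2 / r\<close> up to an
  error \<open>O(\<lambda>\<^sup>4 / r\<^sup>3)\<close> on \<open>[\<lambda>, 1]\<close>, whose integral is \<open>O(\<lambda>\<^sup>2)\<close>.\<close>

subsection \<open>Weak derivatives\<close>

text \<open>The Borel sets over which \<open>f\<close> integrates to zero form a Dynkin system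
  containing the open intervals. These are stable under intersection and generate the Borel sets, so
  \<open>f\<close> and 0 have the same integral over every Borel set.\<close>

lemma AE_zero_of_interval_integrals_lborel:
  fixes f :: "real \<Rightarrow> real"
  assumes f: "integrable lborel f"
    and ivl: "\<And>a b. (LINT x:{a<..<b}|lborel. f x) = 0"
  shows "AE x in lborel. f x = 0"
proof (rule density_unique_real[OF f integrable_zero])
  have int: "set_integrable lborel A f" if "A \<in> sets lborel" for A
    using integrable_mult_indicator[OF that f] by (simp add: set_integrable_def)
  \<comment> \<open>Exhausting the line by symmetric intervals shows that the total integral
    vanishes, as the complement case of the induction requires.\<close>
  have "(\<lambda>n. LINT x:{- real n<..<real n}|lborel. f x)
      \<longlonglongrightarrow> (LINT x:(\<Union>n. {- real n<..<real n})|lborel. f x)"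
    by (rule set_integral_cont_up) (auto simp: incseq_def intro!: int)
  moreover have "(\<Union>n. {- real n<..<real n}) = UNIV"
  proof -
    have "\<exists>n. - real n < x \<and> x < real n" for x
      using reals_Archimedean2[of "\<bar>x\<bar>"] by (force simp: abs_less_iff)
    then show ?thesis by auto
  qed
  ultimately have tot: "(LINT x:UNIV|lborel. f x) = 0"
    by (simp add: ivl LIMSEQ_const_iff)
  fix A :: "real set" assume "A \<in> sets lborel"
  then have A: "A \<in> sigma_sets UNIV (range (\<lambda>(a::real, b). {a<..<b}))"
    by (simp add: borel_eq_box[where 'a=real] box_real)
  have "Int_stable (range (\<lambda>(a::real, b). {a<..<b}))"
    by (auto simp: Int_stable_def image_iff)
  moreover have "range (\<lambda>(a::real, b). {a<..<b}) \<subseteq> Pow UNIV"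
    by simp
  ultimately have "(LINT x:A|lborel. f x) = 0"
    using A
  proof (induction rule: sigma_sets_induct_disjoint)
    case (basic A)
    then show ?case by (auto simp: ivl)
  next
    case empty
    show ?case by (simp add: set_lebesgue_integral_def)
  next
    case (compl A)
    then have "A \<in> sets lborel"
      by (simp add: borel_eq_box[where 'a=real] box_real)
    then have "(LINT x:A \<union> (UNIV - A)|lborel. f x)
        = (LINT x:A|lborel. f x) + (LINT x:UNIV - A|lborel. f x)"
      by (intro set_integral_Un int) auto
    with compl tot show ?case by simp
  next
    case (union A)
    then have "A i \<in> sets lborel" for i
      by (auto simp: borel_eq_box[where 'a=real] box_real)
    then have "(LINT x:(\<Union>i. A i)|lborel. f x) = (\<Sum>i. (LINT x:(A i)|lborel. f x))"
      using union by (intro lebesgue_integral_countable_add int) (auto simp: disjoint_family_on_def)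
    with union show ?case by simp
  qed
  then show "(LINT x:A|lborel. f x) = (LINT x:A|lborel. 0)" by simp
qed

text \<open>Reduces to the Borel case through a Borel representative that agrees with
  \<open>f\<close> almost everywhere.\<close>

lemma AE_zero_of_interval_integrals:
  fixes f :: "real \<Rightarrow> real"
  assumes f: "integrable lebesgue f"
    and ivl: "\<And>a b. (LINT x:{a<..<b}|lebesgue. f x) = 0"
  shows "AE x in lebesgue. f x = 0"
proof -
  obtain g where g [measurable]: "g \<in> borel_measurable lborel"
    and fg: "AE x in lborel. f x = g x"
    using completion_ex_borel_measurable_real[of f lborel] f by auto
  have gl: "g \<in> borel_measurable lebesgue"
    by (rule measurable_completion) fact
  have fg': "AE x in lebesgue. f x = g x"
    using fg by (rule AE_completion)
  have "integrable lebesgue g"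
    using integrable_cong_AE[OF _ gl fg'] f by auto
  then have "integrable lborel g"
    by (simp add: integrable_completion)
  moreover have "(LINT x:{a<..<b}|lborel. g x) = 0" for a b
  proof -
    have "(LINT x:{a<..<b}|lborel. g x) = (LINT x:{a<..<b}|lebesgue. g x)"
      unfolding set_lebesgue_integral_def by (rule integral_completion[symmetric]) measurable
    also have "\<dots> = (LINT x:{a<..<b}|lebesgue. f x)"
      unfolding set_lebesgue_integral_def using fg' f gl
      by (intro integral_cong_AE borel_measurable_scaleR borel_measurable_indicator) auto
    finally show ?thesis by (simp add: ivl)
  qed
  ultimately have "AE x in lborel. g x = 0"
    by (rule AE_zero_of_interval_integrals_lborel)
  then have "AE x in lebesgue. g x = 0"
    by (rule AE_completion)
  with fg' show ?thesis by eventually_elim simp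
qed

section \<open>Basic properties of C1 test functions\<close>

lemma C1_differentiable_onI_real:
  assumes "\<And>x. (f has_real_derivative f' x) (at x)" "continuous_on UNIV f'"
  shows "f C1_differentiable_on UNIV"
  using assms unfolding C1_differentiable_on_def has_real_derivative_iff_has_vector_derivative
  by blast

lemma test_function_DERIV:
  assumes "test_function S \<phi>"
  shows "(\<phi> has_real_derivative deriv \<phi> x) (at x)"
proof -
  obtain D where "(\<phi> has_vector_derivative D x) (at x)"
    using assms by (auto simp: test_function_def C1_differentiable_on_def)
  then show ?thesis
    by (metis DERIV_imp_deriv has_real_derivative_iff_has_vector_derivative)
qed

lemma continuous_on_deriv_test_function:
  assumes "test_function S \<phi>"
  shows "continuous_on A (deriv \<phi>)"
proof -
  obtain D where D: "\<And>x. (\<phi> has_vector_derivative D x) (at x)" "continuous_on UNIV D"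
    using assms by (auto simp: test_function_def C1_differentiable_on_def)
  then have "deriv \<phi> = D"
    by (auto simp: has_real_derivative_iff_has_vector_derivative[symmetric] DERIV_imp_deriv)
  with D(2) show ?thesis by (auto intro: continuous_on_subset)
qed

lemma continuous_on_test_function:
  assumes "test_function S \<phi>"
  shows "continuous_on A \<phi>"
  using test_function_DERIV[OF assms] DERIV_isCont continuous_at_imp_continuous_on by blast

text \<open>One compact set serves both the function and its derivative: the complement of
  \<open>K\<close> is open and the function is constantly 0 there.\<close>

lemma test_function_support:
  assumes "test_function S \<phi>"
  obtains K where "compact K" "K \<subseteq> S" "\<And>x. x \<notin> K \<Longrightarrow> \<phi> x = 0" "\<And>x. x \<notin> K \<Longrightarrow> deriv \<phi> x = 0"
proof -
  obtain K where K: "compact K" "K \<subseteq> S" "\<And>x. x \<notin> K \<Longrightarrow> \<phi> x = 0"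
    using assms by (auto simp: test_function_def)
  have "deriv \<phi> x = 0" if "x \<notin> K" for x
  proof (rule DERIV_imp_deriv)
    have "open (- K)"
      using K(1) by (simp add: compact_imp_closed open_Compl)
    moreover have "((\<lambda>_. 0) has_real_derivative 0) (at x)" by simp
    ultimately show "(\<phi> has_real_derivative 0) (at x)"
      by (rule_tac has_field_derivative_transform_within_open[where S = "- K"]) (use K(3) that in auto)
  qed
  with K show thesis by (intro that)
qed

lemma test_function_mono: "test_function S \<phi> \<Longrightarrow> S \<subseteq> T \<Longrightarrow> test_function T \<phi>"
  unfolding test_function_def by (meson subset_trans)

text \<open>The continuous factor is bounded on \<open>K\<close> and zero off it, so the product is
  dominated by a multiple of \<open>f\<close> on \<open>K\<close>.\<close>

lemma set_integrable_mult_compact_support: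
  fixes f h :: "real \<Rightarrow> real"
  assumes "set_integrable lebesgue K f" "compact K" "K \<subseteq> S"
    and h: "continuous_on UNIV h" "\<And>x. x \<notin> K \<Longrightarrow> h x = 0"
  shows "set_integrable lebesgue S (\<lambda>x. f x * h x)"
proof -
  have "bounded (h ` K)"
    using assms by (meson compact_continuous_image compact_imp_bounded continuous_on_subset subset_UNIV)
  then obtain B where B: "\<And>x. x \<in> K \<Longrightarrow> \<bar>h x\<bar> \<le> B"
    by (auto simp: bounded_iff)
  have [measurable]: "h \<in> borel_measurable lebesgue"
    using h(1) by (simp add: borel_measurable_continuous_onI measurable_completion)
  have fK: "integrable lebesgue (\<lambda>x. indicator K x * f x)"
    using assms(1) by (simp add: set_integrable_def)
  have "integrable lebesgue (\<lambda>x. (indicator K x * f x) * h x)"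
  proof (rule Bochner_Integration.integrable_bound)
    show "integrable lebesgue (\<lambda>x. B * (indicator K x * f x))"
      using fK by simp
    show "(\<lambda>x. (indicator K x * f x) * h x) \<in> borel_measurable lebesgue"
      using borel_measurable_integrable[OF fK] by measurable
    have "norm ((indicator K x * f x) * h x) \<le> norm (B * (indicator K x * f x))" for x
    proof (cases "x \<in> K")
      case True
      then have "\<bar>h x\<bar> * \<bar>f x\<bar> \<le> \<bar>B\<bar> * \<bar>f x\<bar>"
        using B[OF True] by (intro mult_right_mono) auto
      with True show ?thesis by (simp add: abs_mult mult.commute)
    qed auto
    then show "AE x in lebesgue. norm ((indicator K x * f x) * h x) \<le> norm (B * (indicator K x * f x))"
      by simp
  qed
  also have "(\<lambda>x. (indicator K x * f x) * h x) = (\<lambda>x. indicator S x * (f x * h x))"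
    using h(2) \<open>K \<subseteq> S\<close> by (force simp: indicator_def)
  finally show ?thesis by (simp add: set_integrable_def)
qed

text \<open>Squared positive parts are the C1 building blocks of all cut-offs below. At the kink 0
  the difference quotient is at most \<open>\<bar>h\<bar>\<close> in modulus.\<close>

lemma DERIV_pos_part_sq:
  "((\<lambda>x::real. (max 0 x)\<^sup>2) has_real_derivative 2 * max 0 x) (at x)"
proof -
  consider "x < 0" | "x > 0" | "x = 0" by linarith
  then show ?thesis
  proof cases
    case 1
    have "((\<lambda>_. 0) has_real_derivative 0) (at x)" by simp
    then have "((\<lambda>x::real. (max 0 x)\<^sup>2) has_real_derivative 0) (at x)"
      by (rule has_field_derivative_transform_within_open[where S = "{..<0}"]) (use 1 in auto)
    with 1 show ?thesis by simp
  next
    case 2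
    have "((\<lambda>x. x\<^sup>2) has_real_derivative 2 * x) (at x)"
      by (rule derivative_eq_intros refl)+ simp
    then have "((\<lambda>x::real. (max 0 x)\<^sup>2) has_real_derivative 2 * x) (at x)"
      by (rule has_field_derivative_transform_within_open[where S = "{0<..}"]) (use 2 in auto)
    with 2 show ?thesis by simp
  next
    case 3
    have "((\<lambda>h::real. max 0 h * (max 0 h / h)) \<longlongrightarrow> 0) (at 0)"
    proof (rule Lim_null_comparison)
      show "\<forall>\<^sub>F h in at 0. norm (max 0 h * (max 0 h / h)) \<le> \<bar>h\<bar>" for h :: real
        by (rule always_eventually) (auto simp: max_def)
      show "((\<lambda>h::real. \<bar>h\<bar>) \<longlongrightarrow> 0) (at 0)"
        by (rule tendsto_rabs_zero) (rule tendsto_ident_at)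
    qed
    with 3 show ?thesis by (simp add: DERIV_def power2_eq_square)
  qed
qed

lemmas DERIV_pos_part_sq_chain [derivative_intros] =
  DERIV_chain2[OF DERIV_pos_part_sq]

text \<open>C1 bumps converge boundedly to the indicator of an interval, so by dominated convergence
  \<open>f\<close> has zero integral over every interval whose closure lies in
  \<open>S\<close>.\<close>

lemma fundamental_lemma_of_variations:
  assumes f: "locally_integrable_on f S" and "open S"
    and zero: "\<And>\<phi>. test_function S \<phi> \<Longrightarrow> (LINT x:S|lebesgue. f x * \<phi> x) = 0"
  shows "AE x in lebesgue. x \<in> S \<longrightarrow> f x = 0"
proof -
  have ivl: "(LINT x:{c<..<d}|lebesgue. f x) = 0" if cd: "{c..d} \<subseteq> S" for c d
  proof -
    \<comment> \<open>\<open>q\<close> is C1, positive exactly on the open interval, and zero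
      elsewhere; hence \<open>\<phi> n\<close> stays in [0, 1], vanishes with \<open>q\<close>, and
      tends to 1 where \<open>q\<close> is positive.\<close>
    define q where "q x = (max 0 (x - c))\<^sup>2 * (max 0 (d - x))\<^sup>2" for x :: real
    define \<phi> where "\<phi> n x = 1 - exp (- real n * q x)" for n x
    have q0: "q x = 0" if "x \<notin> {c..d}" for x
      using that by (auto simp: q_def max_def)
    have qpos: "q x > 0" if "x \<in> {c<..<d}" for x
      using that by (auto simp: q_def)
    have qedge: "q x = 0" if "x \<notin> {c<..<d}" for x
      using that by (auto simp: q_def max_def)
    have qnn: "q x \<ge> 0" for x by (simp add: q_def)
    have \<phi>0: "\<phi> n x = 0" if "x \<notin> {c..d}" for n x
      using q0[OF that] by (simp add: \<phi>_def)
    have "\<phi> n C1_differentiable_on UNIV" for n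
    proof (rule C1_differentiable_onI_real)
      let ?q' = "\<lambda>x. 2 * max 0 (x - c) * (max 0 (d - x))\<^sup>2 - (max 0 (x - c))\<^sup>2 * (2 * max 0 (d - x))"
      show "(\<phi> n has_real_derivative real n * ?q' x * exp (- real n * q x)) (at x)" for x
        unfolding \<phi>_def q_def by (rule derivative_eq_intros refl)+ (simp add: algebra_simps)
      show "continuous_on UNIV (\<lambda>x. real n * ?q' x * exp (- real n * q x))"
        unfolding q_def by (intro continuous_intros)
    qed
    then have test: "test_function S (\<phi> n)" for n
      using cd \<phi>0 unfolding test_function_def by (intro conjI exI[of _ "{c..d}"]) auto
    have fi: "integrable lebesgue (\<lambda>x. indicator {c..d} x * f x)"
      using f cd by (auto simp: locally_integrable_on_def set_integrable_def)
    have "(\<lambda>n. LINT x|lebesgue. indicator {c..d} x * f x * \<phi> n x)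
        \<longlonglongrightarrow> (LINT x|lebesgue. indicator {c..d} x * f x * indicator {c<..<d} x)"
    proof (rule integral_dominated_convergence)
      show "integrable lebesgue (\<lambda>x. \<bar>indicator {c..d} x * f x\<bar>)"
        using fi by (rule integrable_abs)
      have "(\<lambda>n. \<phi> n x) \<longlonglongrightarrow> indicator {c<..<d} x" for x
      proof (cases "x \<in> {c<..<d}")
        case True
        have "(\<lambda>n. exp (- real n * q x)) \<longlonglongrightarrow> 0"
        proof -
          have "(\<lambda>n. exp (- q x) ^ n) \<longlonglongrightarrow> 0"
            using qpos[OF True] by (intro LIMSEQ_power_zero) auto
          then show ?thesis by (simp add: exp_of_nat_mult[symmetric])
        qed
        then have "(\<lambda>n. 1 - exp (- real n * q x)) \<longlonglongrightarrow> 1 - 0"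
          by (intro tendsto_intros)
        with True show ?thesis by (simp add: \<phi>_def)
      qed (simp add: \<phi>_def qedge)
      then show "AE x in lebesgue. (\<lambda>n. indicator {c..d} x * f x * \<phi> n x)
          \<longlonglongrightarrow> indicator {c..d} x * f x * indicator {c<..<d} x"
        by (intro AE_I2 tendsto_intros)
      have "\<bar>\<phi> n x\<bar> \<le> 1" for n x
        using qnn[of x] by (auto simp: \<phi>_def)
      then have "norm (indicator {c..d} x * f x * \<phi> n x) \<le> \<bar>indicator {c..d} x * f x\<bar>" for n x
        by (simp add: abs_mult mult_left_le)
      then show "AE x in lebesgue. norm (indicator {c..d} x * f x * \<phi> n x) \<le> \<bar>indicator {c..d} x * f x\<bar>" for n
        by simp
      have "\<phi> n \<in> borel_measurable lebesgue" for n
        using borel_measurable_continuous_onI[OF continuous_on_test_function[OF test]]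
        by (intro measurable_completion) simp
      then show "(\<lambda>x. indicator {c..d} x * f x * \<phi> n x) \<in> borel_measurable lebesgue" for n
        by (rule borel_measurable_times[OF borel_measurable_integrable[OF fi]])
      show "(\<lambda>x. indicator {c..d} x * f x * indicator {c<..<d} x) \<in> borel_measurable lebesgue"
        by (intro borel_measurable_times[OF borel_measurable_integrable[OF fi]] borel_measurable_indicator) auto
    qed
    moreover have "(LINT x|lebesgue. indicator {c..d} x * f x * \<phi> n x) = 0" for n
    proof -
      have "(\<lambda>x. indicator {c..d} x * f x * \<phi> n x) = (\<lambda>x. indicator S x *\<^sub>R (f x * \<phi> n x))"
        using cd \<phi>0 by (force simp: indicator_def)
      then show ?thesis
        using zero[OF test] by (simp add: set_lebesgue_integral_def)
    qed
    moreover have "(\<lambda>x. indicator {c..d} x * f x * indicator {c<..<d} x) = (\<lambda>x. indicator {c<..<d} x *\<^sub>R f x)"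
      by (auto simp: indicator_def)
    ultimately show ?thesis
      by (simp add: set_lebesgue_integral_def LIMSEQ_const_iff)
  qed
  have loc: "AE x in lebesgue. x \<in> {c<..<d} \<longrightarrow> f x = 0" if cd: "{c..d} \<subseteq> S" for c d
  proof -
    have "set_integrable lebesgue {c<..<d} f"
      using f cd unfolding locally_integrable_on_def
      by (rule_tac set_integrable_subset[of _ "{c..d}"]) auto
    then have "AE x in lebesgue. indicator {c<..<d} x *\<^sub>R f x = 0"
      unfolding set_integrable_def
    proof (rule AE_zero_of_interval_integrals)
      fix a b
      have "(LINT x:{a<..<b}|lebesgue. indicator {c<..<d} x *\<^sub>R f x)
          = (LINT x:{max a c<..<min b d}|lebesgue. f x)"
        unfolding set_lebesgue_integral_def
        by (intro Bochner_Integration.integral_cong) (auto simp: indicator_def)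
      also have "\<dots> = 0"
        using cd by (intro ivl) auto
      finally show "(LINT x:{a<..<b}|lebesgue. indicator {c<..<d} x *\<^sub>R f x) = 0" .
    qed
    then show ?thesis by eventually_elim (auto simp: indicator_def split: if_splits)
  qed
  \<comment> \<open>Rational endpoints keep the cover of \<open>S\<close> countable, so the
    exceptional null sets can be united.\<close>
  define I where "I = {p \<in> \<rat> \<times> \<rat>. {fst p..snd p} \<subseteq> S}"
  have "countable I"
    unfolding I_def by (rule countable_subset[of _ "\<rat> \<times> \<rat>"]) (auto intro: countable_rat)
  then have "AE x in lebesgue. \<forall>p\<in>I. x \<in> {fst p<..<snd p} \<longrightarrow> f x = 0"
    using loc by (subst AE_ball_countable) (auto simp: I_def)
  then show ?thesis
  proof eventually_elim
    case (elim x)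
    show ?case
    proof
      assume "x \<in> S"
      then obtain e where e: "e > 0" "cball x e \<subseteq> S"
        using \<open>open S\<close> open_contains_cball by blast
      obtain c where c: "c \<in> \<rat>" "x - e < c" "c < x"
        using Rats_dense_in_real[of "x - e" x] e by auto
      obtain d where d: "d \<in> \<rat>" "x < d" "d < x + e"
        using Rats_dense_in_real[of x "x + e"] e by auto
      have "{c..d} \<subseteq> cball x e"
        using c d by (auto simp: dist_real_def)
      then have "(c, d) \<in> I"
        using c d e by (auto simp: I_def)
      with elim c d show "f x = 0" by fastforce
    qed
  qed
qed

section \<open>Restriction, uniqueness and the classical case\<close>

lemma has_weak_deriv_on_subset:
  assumes "has_weak_deriv_on u v S" "T \<subseteq> S"
  shows "has_weak_deriv_on u v T"
  unfolding has_weak_deriv_on_def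
proof (intro conjI allI impI)
  show "locally_integrable_on u T" "locally_integrable_on v T"
    using assms by (auto simp: has_weak_deriv_on_def locally_integrable_on_def)
  fix \<phi> assume \<phi>: "test_function T \<phi>"
  obtain K where K: "K \<subseteq> T" "\<And>x. x \<notin> K \<Longrightarrow> \<phi> x = 0" "\<And>x. x \<notin> K \<Longrightarrow> deriv \<phi> x = 0"
    using test_function_support[OF \<phi>] by metis
  have "indicator S x *\<^sub>R (u x * deriv \<phi> x) = indicator T x *\<^sub>R (u x * deriv \<phi> x)"
    "indicator S x *\<^sub>R (v x * \<phi> x) = indicator T x *\<^sub>R (v x * \<phi> x)" for x
    using K assms(2) by (auto simp: indicator_def)
  moreover have "(LINT x:S|lebesgue. u x * deriv \<phi> x) = - (LINT x:S|lebesgue. v x * \<phi> x)"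
    using assms test_function_mono[OF \<phi>] by (auto simp: has_weak_deriv_on_def)
  ultimately show "(LINT x:T|lebesgue. u x * deriv \<phi> x) = - (LINT x:T|lebesgue. v x * \<phi> x)"
    by (simp only: set_lebesgue_integral_def)
qed

lemma set_integrable_mult_test_function:
  assumes "locally_integrable_on f S" "test_function S \<phi>"
  shows "set_integrable lebesgue S (\<lambda>x. f x * \<phi> x)"
    and "set_integrable lebesgue S (\<lambda>x. f x * deriv \<phi> x)"
proof -
  obtain K where K: "compact K" "K \<subseteq> S" "\<And>x. x \<notin> K \<Longrightarrow> \<phi> x = 0" "\<And>x. x \<notin> K \<Longrightarrow> deriv \<phi> x = 0"
    using test_function_support[OF assms(2)] by metis
  then have "set_integrable lebesgue K f"
    using assms(1) by (simp add: locally_integrable_on_def)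
  then show "set_integrable lebesgue S (\<lambda>x. f x * \<phi> x)" "set_integrable lebesgue S (\<lambda>x. f x * deriv \<phi> x)"
    using K continuous_on_test_function[OF assms(2)] continuous_on_deriv_test_function[OF assms(2)]
    by (auto intro!: set_integrable_mult_compact_support)
qed

text \<open>The difference of two weak derivatives integrates to zero against every test
  function.\<close>

lemma weak_deriv_unique:
  assumes "has_weak_deriv_on u v S" "has_weak_deriv_on u v' S" "open S"
  shows "AE x in lebesgue. x \<in> S \<longrightarrow> v x = v' x"
proof -
  have li: "locally_integrable_on v S" "locally_integrable_on v' S"
    using assms by (auto simp: has_weak_deriv_on_def)
  have "AE x in lebesgue. x \<in> S \<longrightarrow> v x - v' x = 0"
  proof (rule fundamental_lemma_of_variations)
    show "locally_integrable_on (\<lambda>x. v x - v' x) S"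
      using li by (auto simp: locally_integrable_on_def)
    fix \<phi> assume \<phi>: "test_function S \<phi>"
    have "(LINT x:S|lebesgue. (v x - v' x) * \<phi> x)
        = (LINT x:S|lebesgue. v x * \<phi> x) - (LINT x:S|lebesgue. v' x * \<phi> x)"
      using set_integral_diff(2)[OF set_integrable_mult_test_function(1)[OF li(1) \<phi>]
          set_integrable_mult_test_function(1)[OF li(2) \<phi>]]
      by (simp add: left_diff_distrib)
    also have "\<dots> = 0"
      using assms \<phi> by (auto simp: has_weak_deriv_on_def)
    finally show "(LINT x:S|lebesgue. (v x - v' x) * \<phi> x) = 0" .
  qed fact
  then show ?thesis by simp
qed

text \<open>Integration by parts: the product of \<open>u\<close> with a test function is C1 and
  vanishes at the ends of a large interval containing the support.\<close>

lemma has_weak_deriv_on_C1: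
  assumes u: "\<And>x. (u has_real_derivative u' x) (at x)" and u': "continuous_on UNIV u'"
  shows "has_weak_deriv_on u u' S"
  unfolding has_weak_deriv_on_def
proof (intro conjI allI impI)
  have cu: "continuous_on UNIV u"
    using u DERIV_isCont continuous_at_imp_continuous_on by blast
  have li: "locally_integrable_on f S" if "continuous_on UNIV f" for f
    unfolding locally_integrable_on_def
  proof (intro allI impI)
    fix K :: "real set" assume K: "compact K \<and> K \<subseteq> S"
    then obtain B where B: "\<And>x. x \<in> K \<Longrightarrow> \<bar>x\<bar> \<le> B"
      using compact_imp_bounded[of K] by (auto simp: bounded_iff)
    have "f absolutely_integrable_on {- B..B}"
      using that by (intro absolutely_integrable_continuous_real) (auto intro: continuous_on_subset)
    moreover have "K \<subseteq> {- B..B}" using B by (auto simp: abs_le_iff minus_le_iff)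
    moreover have "K \<in> sets lebesgue" using K by (simp add: lmeasurable_compact fmeasurableD)
    ultimately show "f absolutely_integrable_on K"
      by (meson set_integrable_subset)
  qed
  show "locally_integrable_on u S" "locally_integrable_on u' S"
    using li cu u' by auto
  fix \<phi> assume \<phi>: "test_function S \<phi>"
  obtain K where K: "compact K" "K \<subseteq> S" "\<And>x. x \<notin> K \<Longrightarrow> \<phi> x = 0" "\<And>x. x \<notin> K \<Longrightarrow> deriv \<phi> x = 0"
    using test_function_support[OF \<phi>] by metis
  have "bounded K"
    using K(1) by (rule compact_imp_bounded)
  then obtain B where B: "\<And>x. x \<in> K \<Longrightarrow> \<bar>x\<bar> \<le> B"
    by (auto simp: bounded_iff)
  \<comment> \<open>\<open>K\<close> lies strictly inside (-c, c), so \<open>\<phi>\<close> vanishes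
    at both endpoints; the maximum with 0 keeps \<open>c\<close> positive even if \<open>K\<close>
    is empty.\<close>
  define c where "c = max B 0 + 1"
  have c: "\<bar>x\<bar> < c" if "x \<in> K" for x
    using B[OF that] by (auto simp: c_def)
  have cpos: "c > 0" by (simp add: c_def)
  define F where "F x = u x * deriv \<phi> x + u' x * \<phi> x" for x
  have "(LINT x:S|lebesgue. u x * deriv \<phi> x) + (LINT x:S|lebesgue. u' x * \<phi> x)
      = (LINT x:S|lebesgue. F x)"
    unfolding F_def
    using set_integrable_mult_test_function[OF _ \<phi>] li cu u'
    by (intro set_integral_add(2)[symmetric]) auto
  also have "\<dots> = (LINT x|lebesgue. F x * indicator {- c..c} x)"
    unfolding set_lebesgue_integral_def
  proof (rule Bochner_Integration.integral_cong)
    show "indicator S x *\<^sub>R F x = F x * indicator {- c..c} x" for x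
      using K c[of x] by (cases "x \<in> K") (auto simp: F_def indicator_def)
  qed simp
  also have "\<dots> = (LINT x|lborel. F x * indicator {- c..c} x)"
  proof (rule integral_completion)
    have "continuous_on UNIV F"
      unfolding F_def using cu u' continuous_on_test_function[OF \<phi>] continuous_on_deriv_test_function[OF \<phi>]
      by (intro continuous_intros)
    then have "F \<in> borel_measurable borel"
      by (rule borel_measurable_continuous_onI)
    then show "(\<lambda>x. F x * indicator {- c..c} x) \<in> borel_measurable lborel"
      by measurable
  qed
  also have "\<dots> = u c * \<phi> c - u (- c) * \<phi> (- c)"
  proof (rule integral_FTC_Icc_real)
    show "((\<lambda>x. u x * \<phi> x) has_real_derivative F x) (at x)" for x
      using DERIV_mult[OF u test_function_DERIV[OF \<phi>]] by (simp add: F_def add.commute mult.commute)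
    have "continuous_on UNIV F"
      unfolding F_def using cu u' continuous_on_test_function[OF \<phi>] continuous_on_deriv_test_function[OF \<phi>]
      by (intro continuous_intros)
    then show "isCont F x" for x
      by (simp add: continuous_on_eq_continuous_at)
  qed (use cpos in auto)
  also have "\<dots> = 0"
    using K(3)[of c] K(3)[of "- c"] c[of c] c[of "- c"] cpos by fastforce
  finally show "(LINT x:S|lebesgue. u x * deriv \<phi> x) = - (LINT x:S|lebesgue. u' x * \<phi> x)"
    by simp
qed

text \<open>Makes the arbitrary choice in \<open>weak_deriv_on\<close> computable up to a null set,
  as needed to evaluate the energy of an explicit competitor.\<close>

lemma weak_deriv_on_C1:
  assumes "\<And>x. (u has_real_derivative u' x) (at x)" "continuous_on UNIV u'" "open S"
  shows "AE x in lebesgue. x \<in> S \<longrightarrow> weak_deriv_on S u x = u' x"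
proof (rule weak_deriv_unique)
  show "has_weak_deriv_on u u' S"
    using assms by (intro has_weak_deriv_on_C1)
  then show "has_weak_deriv_on u (weak_deriv_on S u) S"
    unfolding weak_deriv_on_def by (rule someI[of "\<lambda>v. has_weak_deriv_on u v S"])
qed fact

lemma W12_on_C1:
  assumes u: "\<And>x. (u has_real_derivative u' x) (at x)" and u': "continuous_on UNIV u'"
  shows "W12_on {a<..<b} u"
proof -
  have L2: "L2_on {a<..<b} f" if "continuous_on UNIV f" for f
    unfolding L2_on_def
  proof
    have "f \<in> borel_measurable lebesgue"
      using borel_measurable_continuous_onI[OF that] by (intro measurable_completion) simp
    then show "set_borel_measurable lebesgue {a<..<b} f"
      unfolding set_borel_measurable_def by (intro borel_measurable_scaleR borel_measurable_indicator) auto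
    have "continuous_on {a..b} (\<lambda>x. (f x)\<^sup>2)"
      using that by (intro continuous_intros) (auto intro: continuous_on_subset)
    then have "set_integrable lebesgue {a..b} (\<lambda>x. (f x)\<^sup>2)"
      by (rule absolutely_integrable_continuous_real)
    then show "set_integrable lebesgue {a<..<b} (\<lambda>x. (f x)\<^sup>2)"
      by (rule set_integrable_subset) auto
  qed
  have "continuous_on UNIV u"
    using u DERIV_isCont continuous_at_imp_continuous_on by blast
  then show ?thesis
    unfolding W12_on_def using L2 u' has_weak_deriv_on_C1[OF u u'] by blast
qed

text \<open>The hypothesis gives a different derivative on each interval; by uniqueness they agree almost
  everywhere on overlaps, so they can be glued along an exhaustion of the half-line.\<close>

lemma has_weak_deriv_on_positive_halfline:
  assumes "\<And>a b. 0 < a \<Longrightarrow> a < b \<Longrightarrow> \<exists>v. has_weak_deriv_on u v {a<..<b}"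
  shows "has_weak_deriv_on u (weak_deriv_on {0<..} u) {0<..}"
proof -
  \<comment> \<open>An increasing exhaustion of the half-line; the shift by 2 makes already the
    first interval nonempty.\<close>
  define S where "S n = {inverse (real n + 2)<..<real n + 2}" for n
  have Spos: "S n \<subseteq> {0<..}" for n
  proof
    fix x assume "x \<in> S n"
    moreover have "0 < inverse (real n + 2)" by simp
    ultimately show "x \<in> {0<..}" unfolding S_def by (auto simp del: inverse_positive_iff_positive)
  qed
  have S_mono: "S m \<subseteq> S n" if "m \<le> n" for m n
  proof -
    have "inverse (real n + 2) \<le> inverse (real m + 2)"
      using that by (intro le_imp_inverse_le) auto
    with that show ?thesis
      by (simp add: S_def greaterThanLessThan_subseteq_greaterThanLessThan)
  qed
  \<comment> \<open>The increasing \<open>S n\<close> are an open cover, so a finite subcover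
    collapses to its largest member.\<close>
  have S_compact: "\<exists>n. K \<subseteq> S n" if K: "compact K" "K \<subseteq> {0<..}" for K
  proof (rule ccontr)
    assume no: "\<nexists>n. K \<subseteq> S n"
    have cover: "K \<subseteq> (\<Union>n. S n)"
    proof
      fix x assume "x \<in> K"
      then have "x > 0" using K by auto
      obtain m where "x < real m" using reals_Archimedean2 by blast
      moreover obtain k where "inverse x < real k" using reals_Archimedean2 by blast
      ultimately have "x < real (m + k) + 2" "inverse x < real (m + k) + 2" by auto
      then have "inverse (real (m + k) + 2) < x"
        using \<open>x > 0\<close> by (metis inverse_inverse_eq less_imp_inverse_less positive_imp_inverse_positive)
      with \<open>x < real (m + k) + 2\<close> show "x \<in> (\<Union>n. S n)"
        unfolding S_def by (intro UN_I[of "m + k"]) auto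
    qed
    obtain N where N: "finite N" "K \<subseteq> (\<Union>n\<in>N. S n)"
      by (rule compactE_image[OF K(1) _ cover]) (auto simp: S_def)
    have "S n \<subseteq> S (Max N)" if "n \<in> N" for n
      using that N(1) by (intro S_mono Max_ge)
    then have "(\<Union>n\<in>N. S n) \<subseteq> S (Max N)"
      by (rule UN_least)
    with N(2) have "K \<subseteq> S (Max N)"
      by (rule subset_trans)
    with no show False by blast
  qed
  have "inverse (real n + 2) < real n + 2" for n
    by (rule order.strict_trans[of _ 1]) (auto simp: field_simps)
  then have "\<exists>v. has_weak_deriv_on u v (S n)" for n
    using assms[of "inverse (real n + 2)" "real n + 2"] by (simp add: S_def)
  then obtain V where V: "\<And>n. has_weak_deriv_on u (V n) (S n)"
    by metis
  \<comment> \<open>Each point uses the derivative from the first \<open>S n\<close> that contains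
    it. On \<open>S n\<close> only the indices up to \<open>n\<close> occur, so uniqueness gives
    \<open>v = V n\<close> there almost everywhere.\<close>
  define v where "v x = V (LEAST n. x \<in> S n) x" for x
  have vV: "AE x in lebesgue. x \<in> S n \<longrightarrow> V n x = v x" for n
  proof -
    have "AE x in lebesgue. x \<in> S k \<longrightarrow> V n x = V k x" if "k \<le> n" for k
      using V S_mono[OF that]
      by (intro weak_deriv_unique[of u]) (auto intro: has_weak_deriv_on_subset simp: S_def)
    then have "AE x in lebesgue. \<forall>k\<in>{..n}. x \<in> S k \<longrightarrow> V n x = V k x"
      by (subst AE_ball_countable) auto
    then show ?thesis
    proof eventually_elim
      case (elim x)
      then show ?case
        unfolding v_def using LeastI[of "\<lambda>k. x \<in> S k" n] Least_le[of "\<lambda>k. x \<in> S k" n] by auto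
    qed
  qed
  have vV': "AE x in lebesgue. indicator A x *\<^sub>R (V n x * h x) = indicator A x *\<^sub>R (v x * h x)"
    if "A \<subseteq> S n" for A n and h :: "real \<Rightarrow> real"
    using vV[of n] by eventually_elim (use that in \<open>auto simp: indicator_def\<close>)
  have "has_weak_deriv_on u v {0<..}"
    unfolding has_weak_deriv_on_def
  proof (intro conjI allI impI)
    show "locally_integrable_on u {0<..}"
      unfolding locally_integrable_on_def
    proof (intro allI impI)
      fix K :: "real set" assume K: "compact K \<and> K \<subseteq> {0<..}"
      then obtain n where "K \<subseteq> S n" using S_compact by blast
      then show "set_integrable lebesgue K u"
        using V[of n] K by (auto simp: has_weak_deriv_on_def locally_integrable_on_def)
    qed
    show "locally_integrable_on v {0<..}"
      unfolding locally_integrable_on_def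
    proof (intro allI impI)
      fix K :: "real set" assume K: "compact K \<and> K \<subseteq> {0<..}"
      then obtain n where n: "K \<subseteq> S n" using S_compact by blast
      then have int: "integrable lebesgue (\<lambda>x. indicator K x *\<^sub>R V n x)"
        using V[of n] K by (auto simp: has_weak_deriv_on_def locally_integrable_on_def set_integrable_def)
      have ae: "AE x in lebesgue. indicator K x *\<^sub>R V n x = indicator K x *\<^sub>R v x"
        using vV'[OF n, of "\<lambda>_. 1"] by simp
      have "(\<lambda>x. indicator K x *\<^sub>R v x) \<in> borel_measurable lebesgue"
        using borel_measurable_AE[OF borel_measurable_integrable[OF int] ae] .
      then show "set_integrable lebesgue K v"
        unfolding set_integrable_def
        using integrable_cong_AE[OF borel_measurable_integrable[OF int] _ ae] int by blast
    qed
    fix \<phi> assume \<phi>: "test_function {0<..} \<phi>"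
    obtain K where K: "compact K" "K \<subseteq> {0<..}" "\<And>x. x \<notin> K \<Longrightarrow> \<phi> x = 0" "\<And>x. x \<notin> K \<Longrightarrow> deriv \<phi> x = 0"
      using test_function_support[OF \<phi>] by metis
    obtain n where n: "K \<subseteq> S n" using S_compact K by blast
    \<comment> \<open>A single \<open>S n\<close> contains the support, so the identity for
      \<open>V n\<close> can be applied and carried over to \<open>v\<close>.\<close>
    have \<phi>n: "test_function (S n) \<phi>"
      using \<phi> K n by (auto simp: test_function_def)
    have "(LINT x:{0<..}|lebesgue. u x * deriv \<phi> x) = (LINT x:S n|lebesgue. u x * deriv \<phi> x)"
      unfolding set_lebesgue_integral_def
      using K n Spos[of n] by (intro Bochner_Integration.integral_cong) (auto simp: indicator_def)
    also have "\<dots> = - (LINT x:S n|lebesgue. V n x * \<phi> x)"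
      using V[of n] \<phi>n by (simp add: has_weak_deriv_on_def)
    also have "(LINT x:S n|lebesgue. V n x * \<phi> x) = (LINT x:S n|lebesgue. v x * \<phi> x)"
    proof -
      have ae: "AE x in lebesgue. indicator (S n) x *\<^sub>R (V n x * \<phi> x) = indicator (S n) x *\<^sub>R (v x * \<phi> x)"
        by (rule vV') simp
      have "locally_integrable_on (V n) (S n)"
        using V[of n] by (simp add: has_weak_deriv_on_def)
      then have "(\<lambda>x. indicator (S n) x *\<^sub>R (V n x * \<phi> x)) \<in> borel_measurable lebesgue"
        using set_integrable_mult_test_function(1)[OF _ \<phi>n] borel_measurable_integrable
        unfolding set_integrable_def by blast
      then show ?thesis
        unfolding set_lebesgue_integral_def using ae borel_measurable_AE[OF _ ae]
        by (intro integral_cong_AE) auto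
    qed
    also have "\<dots> = (LINT x:{0<..}|lebesgue. v x * \<phi> x)"
      unfolding set_lebesgue_integral_def
      using K n Spos[of n] by (intro Bochner_Integration.integral_cong) (auto simp: indicator_def)
    finally show "(LINT x:{0<..}|lebesgue. u x * deriv \<phi> x) = - (LINT x:{0<..}|lebesgue. v x * \<phi> x)" .
  qed
  then show ?thesis
    unfolding weak_deriv_on_def by (rule someI[of "\<lambda>v. has_weak_deriv_on u v {0<..}"])
qed

text \<open>Guarantees that the choice in the energy density really is a weak derivative on the
  half-line.\<close>

lemma W12_loc_has_weak_deriv:
  assumes "(u, w) \<in> W12_loc"
  shows "has_weak_deriv_on u (weak_deriv_on {0<..} u) {0<..}"
  using assms by (intro has_weak_deriv_on_positive_halfline) (auto simp: W12_loc_def W12_on_def)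

subsection \<open>The logarithmic weight\<close>

lemma FTC_lebesgue:
  fixes f F :: "real \<Rightarrow> real"
  assumes "a \<le> b" "\<And>x. x \<in> {a..b} \<Longrightarrow> (F has_real_derivative f x) (at x)" "continuous_on {a..b} f"
  shows "integrable lebesgue (\<lambda>x. indicator {a..b} x * f x)"
    and "(LINT x|lebesgue. indicator {a..b} x * f x) = F b - F a"
proof -
  have f: "f absolutely_integrable_on {a..b}"
    using assms(3) by (rule absolutely_integrable_continuous_real)
  then show "integrable lebesgue (\<lambda>x. indicator {a..b} x * f x)"
    by (simp add: set_integrable_def)
  have "(f has_integral F b - F a) {a..b}"
    using assms(1,2) by (intro fundamental_theorem_of_calculus)
      (auto simp: has_real_derivative_iff_has_vector_derivative[symmetric] intro: has_field_derivative_at_within)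
  then show "(LINT x|lebesgue. indicator {a..b} x * f x) = F b - F a"
    using set_lebesgue_integral_eq_integral(2)[OF f]
    by (simp add: set_lebesgue_integral_def integral_unique)
qed

text \<open>On [l, 1] this is \<open>1 / r\<close> times the squared cut-offs
  \<open>(1 - l / r)\<^sup>2\<close> and \<open>(1 - r)\<^sup>2\<close>, which explains the cube;
  the squares make it C1 at both ends.\<close>

definition log_test :: "real \<Rightarrow> real \<Rightarrow> real" where
  "log_test l r = (max 0 (r - l))\<^sup>2 * (max 0 (1 - r))\<^sup>2 / r ^ 3"

lemma log_test_eq_0: "r \<notin> {l..1} \<Longrightarrow> log_test l r = 0"
  by (auto simp: log_test_def max_def)

text \<open>The expression \<open>max 0 (r - l) + l\<close> equals \<open>r\<close> for r at least l
  and never drops below l, so the formula is visibly continuous on the whole line.\<close>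

lemma DERIV_log_test:
  assumes "0 < l"
  shows "(log_test l has_real_derivative
     2 * max 0 (r - l) * (max 0 (1 - r))\<^sup>2 / (max 0 (r - l) + l) ^ 3
     - 2 * (max 0 (r - l))\<^sup>2 * max 0 (1 - r) / (max 0 (r - l) + l) ^ 3
     - 3 * (max 0 (r - l))\<^sup>2 * (max 0 (1 - r))\<^sup>2 / (max 0 (r - l) + l) ^ 4) (at r)"
proof (cases "r < l")
  case True
  have "((\<lambda>_. 0) has_real_derivative 0) (at r)" by simp
  then have "(log_test l has_real_derivative 0) (at r)"
    by (rule has_field_derivative_transform_within_open[where S = "{..<l}"])
       (use True in \<open>auto simp: log_test_eq_0\<close>)
  with True show ?thesis by simp
next
  case False
  with assms have r: "r > 0" by simp
  have "(log_test l has_real_derivative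
      ((2 * max 0 (r - l) * (max 0 (1 - r))\<^sup>2 - (max 0 (r - l))\<^sup>2 * (2 * max 0 (1 - r))) * r ^ 3
        - (max 0 (r - l))\<^sup>2 * (max 0 (1 - r))\<^sup>2 * (3 * r\<^sup>2)) / (r ^ 3 * r ^ 3)) (at r)"
    unfolding log_test_def using r
    by (auto intro!: derivative_eq_intros simp: algebra_simps)
  moreover have "((2 * c * d\<^sup>2 - c\<^sup>2 * (2 * d)) * r ^ 3 - c\<^sup>2 * d\<^sup>2 * (3 * r\<^sup>2)) / (r ^ 3 * r ^ 3)
      = 2 * c * d\<^sup>2 / r ^ 3 - 2 * c\<^sup>2 * d / r ^ 3 - 3 * c\<^sup>2 * d\<^sup>2 / r ^ 4" for c d
    using r by (simp add: field_simps eval_nat_numeral)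
  moreover have "max 0 (r - l) + l = r" using False by simp
  ultimately show ?thesis by (simp only:)
qed

lemma test_function_log_test:
  assumes "0 < l"
  shows "test_function {0<..} (log_test l)"
  unfolding test_function_def
proof
  have "max 0 (r - l) + l \<noteq> 0" for r
    using assms max.cobounded1[of 0 "r - l"] by linarith
  then show "log_test l C1_differentiable_on UNIV"
    by (intro C1_differentiable_onI_real[OF DERIV_log_test[OF assms]]) (intro continuous_intros, auto)
  show "\<exists>K. compact K \<and> K \<subseteq> {0<..} \<and> (\<forall>x. x \<notin> K \<longrightarrow> log_test l x = 0)"
    using assms by (intro exI[of _ "{l..1}"]) (auto simp: log_test_eq_0)
qed

text \<open>The lower bound differs from \<open>1 / r\<close> by terms whose integral over [l, 1] is
  at most 4, so the logarithm survives up to a constant.\<close>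

lemma log_test_bounds:
  assumes "0 < l" "l \<le> r" "r \<le> 1"
  shows "0 \<le> log_test l r" "log_test l r \<le> 1 / r"
    "1 / r - 2 * l / r\<^sup>2 - 2 \<le> log_test l r" "\<bar>deriv (log_test l) r\<bar> \<le> 5 / r\<^sup>2"
proof -
  have r: "r > 0" using assms by simp
  \<comment> \<open>In these variables, both in [0, 1], the weight is
    \<open>x\<^sup>2 * y\<^sup>2 / r\<close>.\<close>
  define x y where "x = 1 - l / r" and "y = 1 - r"
  have x: "0 \<le> x" "x \<le> 1" and y: "0 \<le> y" "y \<le> 1"
    using assms r by (auto simp: x_def y_def field_simps)
  have c: "max 0 (r - l) = r * x" and d: "max 0 (1 - r) = y"
    using assms r by (auto simp: x_def y_def field_simps)
  have xy: "x\<^sup>2 * y\<^sup>2 \<le> 1" "x * y\<^sup>2 \<le> 1" "x\<^sup>2 * y \<le> 1"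
    using x y by (auto intro!: mult_le_one power_le_one)
  have \<phi>: "log_test l r = x\<^sup>2 * y\<^sup>2 / r"
    unfolding log_test_def c d using r by (simp add: field_simps eval_nat_numeral)
  show "0 \<le> log_test l r" using r by (simp add: \<phi>)
  show "log_test l r \<le> 1 / r" using r xy by (simp add: \<phi> divide_right_mono)
  \<comment> \<open>Two linearisations: \<open>x\<^sup>2 * y\<^sup>2\<close> is at least
    \<open>2 * (x * y) - 1\<close>, and \<open>x * y\<close> is at least
    \<open>x + y - 1\<close>.\<close>
  have "x\<^sup>2 * y\<^sup>2 \<ge> 1 - 2 * (l / r) - 2 * r"
  proof -
    have "(x * y - 1)\<^sup>2 \<ge> 0" by simp
    then have "x\<^sup>2 * y\<^sup>2 \<ge> 2 * (x * y) - 1" by (simp add: power2_eq_square algebra_simps)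
    moreover have "(1 - x) * (1 - y) \<ge> 0" using x y by simp
    then have "x * y \<ge> x + y - 1" by (simp add: algebra_simps)
    moreover have "x + y - 1 = 1 - l / r - r" by (simp add: x_def y_def)
    ultimately show ?thesis by linarith
  qed
  then have "(1 - 2 * (l / r) - 2 * r) / r \<le> x\<^sup>2 * y\<^sup>2 / r"
    using r by (intro divide_right_mono) auto
  moreover have "(1 - 2 * (l / r) - 2 * r) / r = 1 / r - 2 * l / r\<^sup>2 - 2"
    using r by (simp add: field_simps power2_eq_square)
  ultimately show "1 / r - 2 * l / r\<^sup>2 - 2 \<le> log_test l r" by (simp add: \<phi>)
  have "deriv (log_test l) r = 2 * (r * x) * y\<^sup>2 / (r * x + l) ^ 3
     - 2 * (r * x)\<^sup>2 * y / (r * x + l) ^ 3 - 3 * (r * x)\<^sup>2 * y\<^sup>2 / (r * x + l) ^ 4"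
    using DERIV_imp_deriv[OF DERIV_log_test[OF assms(1), of r]] unfolding c d .
  also have "r * x + l = r"
    using r by (simp add: x_def field_simps)
  also have "2 * (r * x) * y\<^sup>2 / r ^ 3 - 2 * (r * x)\<^sup>2 * y / r ^ 3 - 3 * (r * x)\<^sup>2 * y\<^sup>2 / r ^ 4
      = (2 * (x * y\<^sup>2) - 2 * r * (x\<^sup>2 * y) - 3 * (x\<^sup>2 * y\<^sup>2)) / r\<^sup>2"
    using r by (simp add: field_simps eval_nat_numeral)
  finally have "\<bar>deriv (log_test l) r\<bar> = \<bar>2 * (x * y\<^sup>2) - 2 * r * (x\<^sup>2 * y) - 3 * (x\<^sup>2 * y\<^sup>2)\<bar> / r\<^sup>2"
    by simp
  also have "\<dots> \<le> 5 / r\<^sup>2"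
  proof (rule divide_right_mono)
    \<comment> \<open>All three products lie in [0, 1], so the combination lies between -2 - 3 and
      2.\<close>
    have "r * (x\<^sup>2 * y) \<le> 1" "0 \<le> r * (x\<^sup>2 * y)" "0 \<le> x * y\<^sup>2" "0 \<le> x\<^sup>2 * y\<^sup>2"
      using assms r xy x y by (auto intro!: mult_le_one)
    then show "\<bar>2 * (x * y\<^sup>2) - 2 * r * (x\<^sup>2 * y) - 3 * (x\<^sup>2 * y\<^sup>2)\<bar> \<le> 5"
      using xy by linarith
  qed simp
  finally show "\<bar>deriv (log_test l) r\<bar> \<le> 5 / r\<^sup>2" .
qed

subsection \<open>Energy bounds\<close>

text \<open>Here \<open>W\<close>, \<open>p\<close>, \<open>v\<close>, \<open>dw\<close>, \<open>t\<close>, \<open>s\<close> stand for the values at \<open>r\<close> of \<open>w\<^sup>2\<close>, \<open>u'\<close>, \<open>u\<close>, \<open>w'\<close>,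
  \<open>\<phi>\<close>, \<open>\<phi>'\<close>; the term \<open>p * t + v * s\<close> is \<open>(u \<phi>)'\<close>, which integrates to zero.\<close>

lemma density_lower_bound:
  fixes W p v dw l r t s :: real
  assumes "0 < r" "0 \<le> W" "0 \<le> t" "t \<le> 1 / r" "\<bar>s\<bar> \<le> 5 / r\<^sup>2"
  shows "l\<^sup>2 * t - 13 / 2 * l ^ 4 / r ^ 3 - l\<^sup>2 * (p * t + v * s)
    \<le> ((W - 1 + p)\<^sup>2 + (v / r)\<^sup>2 + l\<^sup>2 * (dw\<^sup>2 + W / r\<^sup>2)) * r"
proof -
  define g where "g = W - 1 + p"
  \<comment> \<open>Completing the square absorbs the cross term with \<open>g\<close>; the next
    square does the same for \<open>v * s\<close>.\<close>
  have "0 \<le> r * (g + l\<^sup>2 * t / (2 * r))\<^sup>2"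
    using assms by simp
  also have "\<dots> = g\<^sup>2 * r + l\<^sup>2 * (g * t) + l ^ 4 * (t\<^sup>2 / (4 * r))"
    using assms by (simp add: field_simps eval_nat_numeral)
  finally have 1: "0 \<le> g\<^sup>2 * r + l\<^sup>2 * (g * t) + l ^ 4 * (t\<^sup>2 / (4 * r))" .
  have "0 \<le> (v + l\<^sup>2 * s * r / 2)\<^sup>2 / r"
    using assms by simp
  also have "\<dots> = (v / r)\<^sup>2 * r + l\<^sup>2 * (v * s) + l ^ 4 * (s\<^sup>2 * r / 4)"
    using assms by (simp add: field_simps eval_nat_numeral)
  finally have 2: "0 \<le> (v / r)\<^sup>2 * r + l\<^sup>2 * (v * s) + l ^ 4 * (s\<^sup>2 * r / 4)" .
  \<comment> \<open>The bounds on \<open>t\<close> and \<open>s\<close> turn the two remainders into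
    multiples 1/4 and 25/4 of \<open>l ^ 4 / r ^ 3\<close>, with sum 13/2.\<close>
  have "t\<^sup>2 \<le> (1 / r)\<^sup>2"
    using assms by (intro power_mono) auto
  then have "t\<^sup>2 / (4 * r) \<le> (1 / r)\<^sup>2 / (4 * r)"
    using assms by (intro divide_right_mono) auto
  also have "\<dots> = 1 / 4 / r ^ 3"
    using assms by (simp add: field_simps eval_nat_numeral)
  finally have 3: "l ^ 4 * (t\<^sup>2 / (4 * r)) \<le> l ^ 4 * (1 / 4 / r ^ 3)"
    by (intro mult_left_mono) auto
  have "\<bar>s\<bar>\<^sup>2 \<le> (5 / r\<^sup>2)\<^sup>2"
    using assms by (intro power_mono) auto
  then have "s\<^sup>2 * r / 4 \<le> (5 / r\<^sup>2)\<^sup>2 * r / 4"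
    using assms by (intro divide_right_mono mult_right_mono) auto
  also have "\<dots> = 25 / 4 / r ^ 3"
    using assms by (simp add: field_simps eval_nat_numeral)
  finally have 4: "l ^ 4 * (s\<^sup>2 * r / 4) \<le> l ^ 4 * (25 / 4 / r ^ 3)"
    by (intro mult_left_mono) auto
  have "W * t \<le> W * (1 / r)"
    using assms(4,2) by (rule mult_left_mono)
  then have "l\<^sup>2 * (W * t) \<le> l\<^sup>2 * (W * (1 / r))"
    by (rule mult_left_mono) simp
  also have "\<dots> = l\<^sup>2 * (W / r\<^sup>2) * r"
    using assms by (simp add: field_simps power2_eq_square)
  also have "\<dots> \<le> l\<^sup>2 * (dw\<^sup>2 + W / r\<^sup>2) * r"
    using assms by (intro mult_right_mono mult_left_mono) auto
  finally have 5: "l\<^sup>2 * (W * t) \<le> l\<^sup>2 * (dw\<^sup>2 + W / r\<^sup>2) * r" .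
  \<comment> \<open>Substituting \<open>W = 1 + g - p\<close> produces the main term
    \<open>l\<^sup>2 * t\<close>.\<close>
  have "l\<^sup>2 * (W * t) = l\<^sup>2 * t + l\<^sup>2 * (g * t) - l\<^sup>2 * (p * t)"
    by (simp add: g_def algebra_simps)
  moreover have "l ^ 4 * (1 / 4 / r ^ 3) + l ^ 4 * (25 / 4 / r ^ 3) = 13 / 2 * l ^ 4 / r ^ 3"
    by (simp add: add_divide_distrib[symmetric])
  ultimately show ?thesis
    using 1 2 3 4 5 unfolding g_def[symmetric] by (simp only: distrib_left distrib_right)
qed

text \<open>\<open>ennreal\<close> sends negative values to 0, so the right-hand side integrates the
  positive part. This admits a minorant that changes sign.\<close>

lemma integral_le_nn_integral:
  fixes f :: "'a \<Rightarrow> real"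
  assumes "integrable M f"
  shows "ennreal (\<integral>x. f x \<partial>M) \<le> (\<integral>\<^sup>+x. ennreal (f x) \<partial>M)"
proof -
  have m: "integrable M (\<lambda>x. max 0 (f x))"
    using assms by simp
  have "ennreal (\<integral>x. f x \<partial>M) \<le> ennreal (\<integral>x. max 0 (f x) \<partial>M)"
    using assms m by (intro ennreal_leI integral_mono) auto
  also have "\<dots> = (\<integral>\<^sup>+x. ennreal (max 0 (f x)) \<partial>M)"
    using m by (intro nn_integral_eq_integral[symmetric]) auto
  also have "\<dots> = (\<integral>\<^sup>+x. ennreal (f x) \<partial>M)"
    by (intro nn_integral_cong) (auto simp: max_def ennreal_neg)
  finally show ?thesis .
qed

text \<open>Integrates the pointwise bound; the part containing \<open>u\<close> disappears by the
  definition of the weak derivative.\<close>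

lemma energy_lower_bound:
  assumes l: "0 < l" "l < 1" and u: "has_weak_deriv_on u (weak_deriv_on {0<..} u) {0<..}"
  shows "ennreal (l\<^sup>2 * (- ln l - 8)) \<le> energy l u w"
proof -
  define p where "p = weak_deriv_on {0<..} u"
  define \<phi> where "\<phi> = log_test l"
  \<comment> \<open>The weight is replaced by its elementary lower bound, so that the explicit
    primitive \<open>B\<close> is available.\<close>
  define b where "b r = l\<^sup>2 * (1 / r - 2 * l / r\<^sup>2 - 2) - 13 / 2 * l ^ 4 / r ^ 3" for r
  define F where "F r = indicator {l..1} r * b r
      - l\<^sup>2 * (indicator {0<..} r *\<^sub>R (p r * \<phi> r) + indicator {0<..} r *\<^sub>R (u r * deriv \<phi> r))" for r
  have \<phi>: "test_function {0<..} \<phi>"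
    unfolding \<phi>_def using l by (intro test_function_log_test)
  have out: "\<phi> r = 0" "deriv \<phi> r = 0" if "r \<notin> {l<..<1}" for r
  proof -
    have "max 0 (r - l) = 0 \<or> max 0 (1 - r) = 0" using that by auto
    then show "\<phi> r = 0" "deriv \<phi> r = 0"
      using DERIV_imp_deriv[OF DERIV_log_test[OF l(1), of r]] by (auto simp: \<phi>_def log_test_def)
  qed
  define B where "B r = l\<^sup>2 * (ln r + 2 * l / r - 2 * r) + 13 / 4 * l ^ 4 / r\<^sup>2" for r
  have "(B has_real_derivative b r) (at r)" if "r \<in> {l..1}" for r
    unfolding B_def b_def using l that
    by (auto intro!: derivative_eq_intros simp: field_simps eval_nat_numeral)
  moreover have "continuous_on {l..1} b"
    unfolding b_def using l by (intro continuous_intros) auto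
  ultimately have b: "integrable lebesgue (\<lambda>r. indicator {l..1} r * b r)"
    "(LINT r|lebesgue. indicator {l..1} r * b r) = B 1 - B l"
    using l FTC_lebesgue[of l 1 B b] by auto
  have pu: "integrable lebesgue (\<lambda>r. indicator {0<..} r *\<^sub>R (p r * \<phi> r))"
     "integrable lebesgue (\<lambda>r. indicator {0<..} r *\<^sub>R (u r * deriv \<phi> r))"
    using u set_integrable_mult_test_function[OF _ \<phi>]
    unfolding p_def has_weak_deriv_on_def set_integrable_def by blast+
  have "(LINT r|lebesgue. indicator {0<..} r *\<^sub>R (p r * \<phi> r))
      + (LINT r|lebesgue. indicator {0<..} r *\<^sub>R (u r * deriv \<phi> r)) = 0"
    using u \<phi> unfolding p_def has_weak_deriv_on_def set_lebesgue_integral_def by simp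
  with b pu have F: "integrable lebesgue F" "(LINT r|lebesgue. F r) = B 1 - B l"
    unfolding F_def by auto
  \<comment> \<open>The loss is 4 from the cut-offs and 13/4 from the squares, together below
    8.\<close>
  have "l\<^sup>2 * (- ln l - 8) \<le> l\<^sup>2 * (4 * l + 13 / 4 * l\<^sup>2 + (- ln l - 4 - 13 / 4))"
  proof (rule mult_left_mono)
    have "0 \<le> 4 * l" "0 \<le> 13 / 4 * l\<^sup>2" using l by auto
    then show "- ln l - 8 \<le> 4 * l + 13 / 4 * l\<^sup>2 + (- ln l - 4 - 13 / 4)" by linarith
  qed simp
  also have "\<dots> = B 1 - B l"
    using l unfolding B_def by (simp add: field_simps eval_nat_numeral)
  finally have "ennreal (l\<^sup>2 * (- ln l - 8)) \<le> ennreal (LINT r|lebesgue. F r)"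
    unfolding F by (rule ennreal_leI)
  also have "\<dots> \<le> (\<integral>\<^sup>+r. ennreal (F r) \<partial>lebesgue)"
    using F(1) by (rule integral_le_nn_integral)
  also have "\<dots> \<le> energy l u w"
    unfolding energy_def
  proof (rule nn_integral_mono)
    fix r :: real
    show "ennreal (F r) \<le> ennreal (energy_density l u w r * r) * indicator {0<..<1} r"
    proof (cases "r \<in> {l..<1}")
      case True
      then have r: "0 < r" "l \<le> r" "r \<le> 1" using l by auto
      note bd = log_test_bounds[OF l(1) r(2,3), folded \<phi>_def]
      have "F r = b r - l\<^sup>2 * (p r * \<phi> r + u r * deriv \<phi> r)"
        using True r by (simp add: F_def)
      also have "b r \<le> l\<^sup>2 * \<phi> r - 13 / 2 * l ^ 4 / r ^ 3"
        unfolding b_def using bd(3) by (intro diff_right_mono mult_left_mono) auto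
      also have "l\<^sup>2 * \<phi> r - 13 / 2 * l ^ 4 / r ^ 3 - l\<^sup>2 * (p r * \<phi> r + u r * deriv \<phi> r)
          \<le> energy_density l u w r * r"
        unfolding energy_density_def p_def[symmetric]
        using r bd by (intro density_lower_bound) auto
      finally show ?thesis using True r by (simp add: ennreal_leI)
    next
      case False
      \<comment> \<open>The endpoint 1 belongs to \<open>{l..1}\<close> but not to the domain of the
        energy; there \<open>\<phi>\<close> and its derivative vanish and \<open>b\<close> is
        nonpositive.\<close>
      have "0 \<le> l\<^sup>2 * (1 + 2 * l)" "0 \<le> 13 / 2 * l ^ 4"
        using l by auto
      moreover have "b 1 = - (l\<^sup>2 * (1 + 2 * l)) - 13 / 2 * l ^ 4"
        by (simp add: b_def algebra_simps)
      ultimately have "b 1 \<le> 0" by linarith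
      with False have "F r \<le> 0"
        using out[of r] by (cases "r = 1") (auto simp: F_def mult_nonneg_nonpos)
      then show ?thesis by (simp add: ennreal_neg)
    qed
  qed
  finally show ?thesis .
qed

text \<open>The competitor is linear to first order at the origin, which keeps \<open>w / r\<close>
  bounded, and beyond the scale \<open>l\<close> it approaches 1, making
  \<open>w\<^sup>2 - 1\<close> small. Only the \<open>w\<^sup>2 / r\<^sup>2\<close> term yields a
  logarithm.\<close>

lemma energy_upper_bound:
  assumes l: "0 < l" "l < 1"
  obtains u w where "(u, w) \<in> W12_loc" "energy l u w \<le> ennreal (l\<^sup>2 * (- ln l + 2))"
proof
  define w where "w r = r / sqrt (r\<^sup>2 + l\<^sup>2)" for r
  define w' where "w' r = l\<^sup>2 / sqrt (r\<^sup>2 + l\<^sup>2) ^ 3" for r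
  have pos: "r\<^sup>2 + l\<^sup>2 > 0" for r
    using l by (simp add: add_nonneg_pos)
  have w: "(w has_real_derivative w' r) (at r)" for r
  proof -
    define s where "s = sqrt (r\<^sup>2 + l\<^sup>2)"
    have s: "s > 0" "r\<^sup>2 + l\<^sup>2 = s\<^sup>2"
      using pos[of r] by (auto simp: s_def)
    have "((\<lambda>r. sqrt (r\<^sup>2 + l\<^sup>2)) has_real_derivative r / s) (at r)"
      unfolding s_def using pos[of r] by (auto intro!: derivative_eq_intros simp: field_simps)
    then have "(w has_real_derivative (1 * s - r * (r / s)) / (s * s)) (at r)"
      unfolding w_def using DERIV_divide[OF DERIV_ident, of "\<lambda>r. sqrt (r\<^sup>2 + l\<^sup>2)" "r / s" r UNIV] s(1) l
      by (simp add: s_def)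
    also have "(1 * s - r * (r / s)) / (s * s) = l\<^sup>2 / s ^ 3"
      using s by (simp add: field_simps eval_nat_numeral)
    finally show ?thesis by (simp add: w'_def s_def)
  qed
  have "sqrt (r\<^sup>2 + l\<^sup>2) \<noteq> 0" for r using pos[of r] by (metis less_irrefl real_sqrt_eq_zero_cancel_iff)
  then have w': "continuous_on UNIV w'"
    unfolding w'_def by (intro continuous_intros) auto
  show "((\<lambda>_. 0), w) \<in> W12_loc"
    unfolding W12_loc_def using W12_on_C1[OF w w'] W12_on_C1[of "\<lambda>_. 0" "\<lambda>_. 0"] by auto
  \<comment> \<open>The summands are, in order, the contributions of \<open>w\<^sup>2 - 1\<close>,
    of \<open>w'\<close> and of \<open>w / r\<close>, each already multiplied by
    \<open>r\<close>.\<close>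
  define e where "e r = l ^ 4 * r / (r\<^sup>2 + l\<^sup>2)\<^sup>2 + l ^ 6 * r / (r\<^sup>2 + l\<^sup>2) ^ 3 + l\<^sup>2 * r / (r\<^sup>2 + l\<^sup>2)" for r
  define E where "E r = - (l ^ 4) / (2 * (r\<^sup>2 + l\<^sup>2)) - l ^ 6 / (4 * (r\<^sup>2 + l\<^sup>2)\<^sup>2) + l\<^sup>2 / 2 * ln (r\<^sup>2 + l\<^sup>2)" for r
  have E: "(E has_real_derivative e r) (at r)" for r
  proof -
    \<comment> \<open>\<open>E\<close> depends on \<open>r\<close> only through
      \<open>r\<^sup>2 + l\<^sup>2\<close>, so the chain rule reduces to this function.\<close>
    define G where "G t = - (l ^ 4) / (2 * t) - l ^ 6 / (4 * t\<^sup>2) + l\<^sup>2 / 2 * ln t" for t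
    have G: "(G has_real_derivative l ^ 4 / (2 * t\<^sup>2) + l ^ 6 / (2 * t ^ 3) + l\<^sup>2 / (2 * t)) (at t)"
      if "t > 0" for t
      unfolding G_def using that
      by (auto intro!: derivative_eq_intros simp: field_simps eval_nat_numeral)
    have "((\<lambda>r. r\<^sup>2 + l\<^sup>2) has_real_derivative 2 * r) (at r)"
      by (rule derivative_eq_intros refl)+ simp
    then have "((\<lambda>r. G (r\<^sup>2 + l\<^sup>2)) has_real_derivative (l ^ 4 / (2 * (r\<^sup>2 + l\<^sup>2)\<^sup>2)
        + l ^ 6 / (2 * (r\<^sup>2 + l\<^sup>2) ^ 3) + l\<^sup>2 / (2 * (r\<^sup>2 + l\<^sup>2))) * (2 * r)) (at r)"
      by (rule DERIV_chain2[where f = G and g = "\<lambda>r. r\<^sup>2 + l\<^sup>2" and x = r, OF G[OF pos]])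
    moreover have "(\<lambda>r. G (r\<^sup>2 + l\<^sup>2)) = E"
      by (simp add: G_def E_def fun_eq_iff)
    moreover have "(l ^ 4 / (2 * t\<^sup>2) + l ^ 6 / (2 * t ^ 3) + l\<^sup>2 / (2 * t)) * (2 * r)
        = l ^ 4 * r / t\<^sup>2 + l ^ 6 * r / t ^ 3 + l\<^sup>2 * r / t" if "t > 0" for t
      using that by (simp add: field_simps eval_nat_numeral)
    from this[OF pos[of r]]
    have "(l ^ 4 / (2 * (r\<^sup>2 + l\<^sup>2)\<^sup>2) + l ^ 6 / (2 * (r\<^sup>2 + l\<^sup>2) ^ 3) + l\<^sup>2 / (2 * (r\<^sup>2 + l\<^sup>2)))
        * (2 * r) = e r"
      by (simp only: e_def)
    ultimately show ?thesis by (simp only:)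
  qed
  have dens: "((w r)\<^sup>2 - 1 + 0)\<^sup>2 + (0 / r)\<^sup>2 + l\<^sup>2 * ((w' r)\<^sup>2 + (w r)\<^sup>2 / r\<^sup>2) = e r / r" if "r > 0" for r
  proof -
    define t where "t = r\<^sup>2 + l\<^sup>2"
    have t: "t > 0" using pos by (simp add: t_def)
    have w2: "(w r)\<^sup>2 = r\<^sup>2 / t"
      using t by (simp add: w_def power_divide t_def)
    have w'2: "(w' r)\<^sup>2 = l ^ 4 / t ^ 3"
    proof -
      have "(sqrt t ^ 3)\<^sup>2 = (sqrt t ^ 2) ^ 3"
        by (simp only: power_mult[symmetric] mult.commute)
      then show ?thesis
        using t by (simp add: w'_def t_def[symmetric] power_divide power_mult[symmetric])
    qed
    have rt: "r\<^sup>2 / t - 1 + 0 = - l\<^sup>2 / t"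
    proof -
      have "r\<^sup>2 = t - l\<^sup>2" by (simp add: t_def)
      with t show ?thesis by (simp add: diff_divide_distrib)
    qed
    show ?thesis
      unfolding e_def t_def[symmetric] w2 w'2 rt using t that
      by (simp add: field_simps eval_nat_numeral)
  qed
  have "AE r in lebesgue. r \<in> {0<..} \<longrightarrow> weak_deriv_on {0<..} (\<lambda>_. 0) r = 0"
    by (rule weak_deriv_on_C1) auto
  moreover have "AE r in lebesgue. r \<in> {0<..} \<longrightarrow> weak_deriv_on {0<..} w r = w' r"
    by (rule weak_deriv_on_C1[OF w w']) auto
  \<comment> \<open>The chosen weak derivatives are known only almost everywhere; the closed
    interval prepares the fundamental theorem.\<close>
  ultimately have ae: "AE r in lebesgue.
     ennreal (energy_density l (\<lambda>_. 0) w r * r) * indicator {0<..<1} r \<le> ennreal (e r) * indicator {0..1} r"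
  proof eventually_elim
    case (elim r)
    show ?case
    proof (cases "r \<in> {0<..<1}")
      case True
      with elim have "energy_density l (\<lambda>_. 0) w r = e r / r"
        unfolding energy_density_def by (simp add: dens[simplified])
      with True show ?thesis by simp
    qed simp
  qed
  have "energy l (\<lambda>_. 0) w \<le> (\<integral>\<^sup>+r. ennreal (e r) * indicator {0..1} r \<partial>lebesgue)"
    unfolding energy_def by (rule nn_integral_mono_AE[OF ae])
  also have "\<dots> = (\<integral>\<^sup>+r. ennreal (e r) * indicator {0..1} r \<partial>lborel)"
    by (rule nn_integral_completion)
  also have "\<dots> = ennreal (E 1 - E 0)"
  proof (rule nn_integral_FTC_Icc[OF _ E])
    show "e \<in> borel_measurable borel"
      unfolding e_def by measurable
    show "0 \<le> e r" if "r \<in> {0..1}" for r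
      using that pos[of r] unfolding e_def by (intro add_nonneg_nonneg divide_nonneg_nonneg) auto
  qed simp
  also have "\<dots> \<le> ennreal (l\<^sup>2 * (- ln l + 2))"
  proof (rule ennreal_leI)
    have l2: "l\<^sup>2 > 0" "l\<^sup>2 \<le> 1" using l by (auto simp: power_le_one)
    have "ln (1 + l\<^sup>2) \<le> l\<^sup>2" using l by (intro ln_add_one_self_le_self) auto
    then have "ln (1 + l\<^sup>2) \<le> 1" using l2 by linarith
    then have 1: "l\<^sup>2 / 2 * ln (1 + l\<^sup>2) \<le> l\<^sup>2 / 2 * 1" using l by (intro mult_left_mono) auto
    have "0 \<le> l ^ 4 / (2 * (1 + l\<^sup>2))" "0 \<le> l ^ 6 / (4 * (1 + l\<^sup>2)\<^sup>2)"
      by auto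
    with 1 have "E 1 \<le> l\<^sup>2 / 2"
      unfolding E_def one_power2 minus_divide_left[symmetric] by linarith
    moreover have "E 0 = - l\<^sup>2 / 2 - l\<^sup>2 / 4 + l\<^sup>2 * ln l"
    proof -
      have "ln (l\<^sup>2) = 2 * ln l" using l by (simp add: ln_realpow)
      moreover have "l ^ 4 / (2 * l\<^sup>2) = l\<^sup>2 / 2" "l ^ 6 / (4 * (l\<^sup>2)\<^sup>2) = l\<^sup>2 / 4"
        using l by (simp_all add: field_simps eval_nat_numeral)
      ultimately show ?thesis by (simp add: E_def)
    qed
    \<comment> \<open>The constants add up to 1/2 + 1/2 + 1/4, which is below 2.\<close>
    ultimately show "E 1 - E 0 \<le> l\<^sup>2 * (- ln l + 2)"
      using l2(1) unfolding distrib_left mult_minus_right by linarith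
  qed
  finally show "energy l (\<lambda>_. 0) w \<le> ennreal (l\<^sup>2 * (- ln l + 2))" .
qed

text \<open>The comparison takes place in \<open>ereal\<close> because the lower bound may be
  negative while \<open>inf_energy\<close> is an \<open>ennreal\<close>.\<close>

theorem corollary1:
  "\<exists>R0 C :: real. R0 \<ge> 1 \<and>
     (\<forall>l::real. 0 < l \<and> l < inverse R0 \<longrightarrow>
        ereal (\<bar>ln l\<bar> - C) \<le> ereal (inverse (l\<^sup>2)) * enn2ereal (inf_energy l) \<and>
        ereal (inverse (l\<^sup>2)) * enn2ereal (inf_energy l) \<le> ereal (\<bar>ln l\<bar> + C))"
\<comment> \<open>Both estimates hold on all of (0, 1), so R0 = 1 works; C = 8 is dictated by the
  lower bound, the upper one giving 2.\<close>
proof (rule exI[of _ 1], rule exI[of _ 8], intro conjI allI impI)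
  fix l :: real assume "0 < l \<and> l < inverse 1"
  then have l: "0 < l" "l < 1" by auto
  then have ln: "\<bar>ln l\<bar> = - ln l" by simp
  have scale: "ereal a = ereal (inverse (l\<^sup>2)) * ereal (l\<^sup>2 * a)" for a
    using l by simp
  have "ennreal (l\<^sup>2 * (\<bar>ln l\<bar> - 8)) \<le> inf_energy l"
    unfolding inf_energy_def ln
    using l W12_loc_has_weak_deriv by (intro Inf_greatest) (auto intro!: energy_lower_bound)
  then have "enn2ereal (ennreal (l\<^sup>2 * (\<bar>ln l\<bar> - 8))) \<le> enn2ereal (inf_energy l)"
    by (simp add: less_eq_ennreal.rep_eq)
  \<comment> \<open>Only an inequality is available: \<open>ennreal\<close> truncates the left side
    when \<open>\<bar>ln l\<bar>\<close> is below 8.\<close>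
  moreover have "ereal (l\<^sup>2 * (\<bar>ln l\<bar> - 8)) \<le> enn2ereal (ennreal (l\<^sup>2 * (\<bar>ln l\<bar> - 8)))"
    by (simp add: ennreal.rep_eq)
  ultimately have "ereal (l\<^sup>2 * (\<bar>ln l\<bar> - 8)) \<le> enn2ereal (inf_energy l)"
    by (rule order_trans[rotated])
  then show "ereal (\<bar>ln l\<bar> - 8) \<le> ereal (inverse (l\<^sup>2)) * enn2ereal (inf_energy l)"
    unfolding scale[of "\<bar>ln l\<bar> - 8"] by (rule ereal_mult_left_mono) simp
  obtain u w where uw: "(u, w) \<in> W12_loc" "energy l u w \<le> ennreal (l\<^sup>2 * (- ln l + 2))"
    using energy_upper_bound[OF l] .
  \<comment> \<open>Finiteness admits the competitor to the set over which the infimum is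
    taken.\<close>
  then have "energy l u w < \<infinity>"
    using ennreal_less_top le_less_trans by (metis infinity_ennreal_def)
  with uw have "inf_energy l \<le> energy l u w"
    unfolding inf_energy_def by (intro Inf_lower) auto
  also have "\<dots> \<le> ennreal (l\<^sup>2 * (\<bar>ln l\<bar> + 8))"
  proof -
    have "l\<^sup>2 * (- ln l + 2) \<le> l\<^sup>2 * (\<bar>ln l\<bar> + 8)"
      unfolding ln by (rule mult_left_mono) simp_all
    then show ?thesis using uw(2) ennreal_leI order_trans by blast
  qed
  finally have "enn2ereal (inf_energy l) \<le> enn2ereal (ennreal (l\<^sup>2 * (\<bar>ln l\<bar> + 8)))"
    by (simp add: less_eq_ennreal.rep_eq)
  also have "\<dots> = ereal (l\<^sup>2 * (\<bar>ln l\<bar> + 8))"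
    by (simp add: enn2ereal_ennreal)
  finally show "ereal (inverse (l\<^sup>2)) * enn2ereal (inf_energy l) \<le> ereal (\<bar>ln l\<bar> + 8)"
    unfolding scale[of "\<bar>ln l\<bar> + 8"] by (rule ereal_mult_left_mono) simp
qed simp

end
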